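(* Let $p$ be a prime, let $G$ be a finite $p$-group and let $i$ be a non-negative integer. If $G$ is an $\mathcal{M}_i$ group with $d(G)\geq i+2$, then $G$ is powerful.
   Context: For a finite $p$-group $G$ and $k\ge 0$, $\mho_k(G)=\langle g^{p^k} \mid g\in G\rangle$. For $p$ odd, a finite $p$-group $G$ is powerful if $[G,G]\leq \mho_1(G)$; a finite $2$-group $G$ is powerful if $[G,G]\leq \mho_2(G)$. A finite $p$-group $G$ is an $\mathcal{M}_i$ group if all subgroups of index $p^i$ in $G$ are powerful. $d(G)$ denotes the minimal number of generators of $G$. *)

theory Defs
  imports "HOL-Algebra.Generated_Groups" "HOL-Computational_Algebra.Primes"
begin

definition finite_p_group :: "nat \<Rightarrow> ('a, 'b) monoid_scheme \<Rightarrow> bool" where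
  "finite_p_group p G \<longleftrightarrow> group G \<and> finite (carrier G) \<and> (\<exists>n. order G = p ^ n)"

definition agemo :: "('a, 'b) monoid_scheme \<Rightarrow> nat \<Rightarrow> nat \<Rightarrow> 'a set" where
  "agemo G p k = generate G {g [^]\<^bsub>G\<^esub> (p ^ k :: nat) | g. g \<in> carrier G}"

text \<open>The notions below are meant for finite \<open>p\<close>-groups \<open>G\<close>.\<close>

definition powerful :: "nat \<Rightarrow> ('a, 'b) monoid_scheme \<Rightarrow> bool" where
  "powerful p G \<longleftrightarrow>
     derived G (carrier G) \<subseteq> (if p = 2 then agemo G p 2 else agemo G p 1)"

definition M_group :: "nat \<Rightarrow> nat \<Rightarrow> ('a, 'b) monoid_scheme \<Rightarrow> bool" where
  "M_group p i G \<longleftrightarrow>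
     (\<forall>H. subgroup H G \<and> card (rcosets\<^bsub>G\<^esub> H) = p ^ i \<longrightarrow> powerful p (G\<lparr>carrier := H\<rparr>))"

text \<open>The minimum is attained only if \<open>G\<close> is finitely generated; it is used for finite \<open>G\<close>.\<close>

definition min_generators :: "('a, 'b) monoid_scheme \<Rightarrow> nat" where
  "min_generators G =
     (LEAST n. \<exists>S. S \<subseteq> carrier G \<and> finite S \<and> card S = n \<and> generate G S = carrier G)"

end

theory Submission
  imports Defs "HOL-Algebra.Zassenhaus" "HOL-Algebra.Sylow"
begin

text \<open>
  Powerfulness is a condition on single commutators: since \<open>agemo G p e\<close> is a subgroup, it suffices
  that \<open>[x, y]\<close> lies in it for all \<open>x\<close> and \<open>y\<close>. The hypothesis on the number of generators makes
  the two-generated subgroup \<open>\<langle>x, y\<rangle>\<close> small enough to fit into a subgroup \<open>K\<close> of index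
  \<open>p ^ i\<close>. Such a \<open>K\<close> is powerful, so \<open>[x, y]\<close> is a product of powers of elements of \<open>K\<close> with the
  right exponent, and these are also powers of elements of \<open>G\<close>.

  The existence of \<open>K\<close> has two ingredients. Each element added to a generating set of a proper
  subgroup of a p-group divides its index by at least \<open>p\<close>; so if \<open>\<langle>x, y\<rangle>\<close> has index
  \<open>p ^ j\<close>, then \<open>G\<close> has at most \<open>2 + j\<close> generators
  (\<open>p_group_min_generators_le_log_index\<close>), whence \<open>j \<ge> i\<close>. Conversely, between a
  subgroup and the whole p-group there is a chain in which every step has index \<open>p\<close>, so that no
  index is skipped (\<open>p_group_subgroup_of_index_above\<close>). The steps of the chain come from the growth of
  normalizers in p-groups (\<open>p_group_normalizer_grows\<close>), which in turn is a count of the fixed points of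
  \<open>H\<close> acting on its own cosets.
\<close>

section \<open>Actions of p-groups\<close>

text \<open>
  Orbit sizes divide the order of the group, so every orbit which is not a fixed point has size
  divisible by \<open>p\<close>; the moved points are the disjoint union of these orbits.
\<close>
lemma (in group_action) p_group_dvd_card_moved_points:
  assumes p: "Factorial_Ring.prime (p :: nat)" and ord: "order G = p ^ n" and fin: "finite E"
  shows "p dvd card (E - {x \<in> E. \<forall>g \<in> carrier G. \<phi> g x = x})"
proof -
  let ?F = "{x \<in> E. \<forall>g \<in> carrier G. \<phi> g x = x}"
  let ?C = "{A \<in> orbits G E \<phi>. card A \<noteq> 1}"
  have fixed: "card (orbit G \<phi> x) = 1 \<longleftrightarrow> x \<in> ?F" if x: "x \<in> E" for x
  proof
    assume "card (orbit G \<phi> x) = 1"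
    then obtain y where "orbit G \<phi> x = {y}" by (rule card_1_singletonE)
    with orbit_refl[OF x] have "orbit G \<phi> x = {x}" by auto
    then show "x \<in> ?F" using x by (auto simp: orbit_def)
  next
    assume "x \<in> ?F"
    with orbit_refl[OF x] have "orbit G \<phi> x = {x}" by (auto simp: orbit_def)
    then show "card (orbit G \<phi> x) = 1" by simp
  qed
  have union: "\<Union>?C = E - ?F"
  proof (intro equalityI subsetI)
    fix x assume "x \<in> \<Union>?C"
    then obtain A where A: "A \<in> orbits G E \<phi>" "card A \<noteq> 1" "x \<in> A" by blast
    then have xE: "x \<in> E" using orbits_coverture by blast
    then have "orbit G \<phi> x \<in> orbits G E \<phi>" by (auto simp: orbits_def)
    then have "A = orbit G \<phi> x" using disjoint_union[OF A(1)] A(3) orbit_refl[OF xE] by blast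
    with A(2) fixed[OF xE] xE show "x \<in> E - ?F" by blast
  next
    fix x assume "x \<in> E - ?F"
    then have "orbit G \<phi> x \<in> ?C" "x \<in> orbit G \<phi> x"
      using fixed[of x] orbit_refl[of x] unfolding orbits_def by blast+
    then show "x \<in> \<Union>?C" by blast
  qed
  have "p dvd card (\<Union>?C)"
  proof (rule dvd_partition)
    show "finite (\<Union>?C)" using union fin by simp
    show "\<forall>c\<in>?C. p dvd card c"
    proof
      fix A assume A: "A \<in> ?C"
      then obtain x where "x \<in> E" "A = orbit G \<phi> x" by (auto simp: orbits_def)
      then have "card A dvd p ^ n" using orbit_stabilizer_theorem ord by (metis dvd_triv_left)
      then obtain k where k: "card A = p ^ k" using divides_primepow_nat[OF p] by blast
      with A have "k \<noteq> 0" by (intro notI) simp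
      with k show "p dvd card A" by simp
    qed
    show "\<forall>c1\<in>?C. \<forall>c2\<in>?C. c1 \<noteq> c2 \<longrightarrow> c1 \<inter> c2 = {}"
      using disjoint_union by blast
  qed
  then show ?thesis using union by simp
qed

text \<open>
  The inverse turns right multiplication, which by itself reverses products, into a homomorphism.
\<close>
lemma (in group) action_on_right_cosets:
  assumes H: "subgroup H G"
  shows "group_action G (rcosets H) (\<lambda>g. \<lambda>C \<in> rcosets H. C #> inv g)"
    (is "group_action G ?E ?\<phi>")
proof -
  have closed: "C #> g \<in> ?E" if "C \<in> ?E" "g \<in> carrier G" for C g
    using that subgroup.subset[OF H] by (auto simp: RCOSETS_def coset_mult_assoc)
  have sub: "C \<subseteq> carrier G" if "C \<in> ?E" for C
    using subgroup.rcosets_carrier[OF H is_group that] .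
  have bij: "?\<phi> g \<in> Bij ?E" if g: "g \<in> carrier G" for g
  proof -
    have "bij_betw (?\<phi> g) ?E ?E"
      by (rule bij_betw_byWitness[where f' = "\<lambda>C. C #> g"])
         (use g in \<open>auto simp: closed sub coset_mult_assoc\<close>)
    then show ?thesis by (simp add: Bij_def)
  qed
  have "?\<phi> \<in> hom G (BijGroup ?E)"
  proof (rule homI)
    fix g h assume gh: "g \<in> carrier G" "h \<in> carrier G"
    have "?\<phi> (g \<otimes> h) = compose ?E (?\<phi> g) (?\<phi> h)"
      unfolding compose_def using gh
      by (intro restrict_ext) (simp add: closed sub coset_mult_assoc inv_mult_group)
    then show "?\<phi> (g \<otimes> h) = ?\<phi> g \<otimes>\<^bsub>BijGroup ?E\<^esub> ?\<phi> h"
      using gh bij by (simp add: BijGroup_def)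
  qed (use bij in \<open>simp add: BijGroup_def\<close>)
  then show ?thesis
    by (simp add: group_action_def group_hom_def group_hom_axioms_def group_BijGroup)
qed

section \<open>Subgroups between a given subgroup and a p-group\<close>

text \<open>
  Let \<open>H\<close> act on its right cosets by right multiplication. A coset \<open>H #> g\<close> is fixed exactly if
  \<open>g\<close> normalizes \<open>H\<close>. The index of \<open>H\<close> is a nontrivial power of \<open>p\<close>, so the number of fixed cosets
  is divisible by \<open>p\<close>. As \<open>H\<close> itself is one of them, there is another one, and its
  representative is a normalizing element outside \<open>H\<close>.
\<close>
lemma (in group) p_group_normalizer_grows:
  assumes p: "Factorial_Ring.prime p" and ord: "order G = p ^ n"
    and H: "subgroup H G" and proper: "H \<noteq> carrier G"
  obtains g where "g \<in> normalizer G H" "g \<notin> H"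
proof -
  have finG: "finite (carrier G)"
    using ord p order_gt_0_iff_finite prime_gt_0_nat by simp
  have sub: "H \<subseteq> carrier G" using H by (rule subgroup.subset)
  let ?\<phi> = "\<lambda>g. \<lambda>C \<in> rcosets H. C #> inv g"
  let ?F = "{C \<in> rcosets H. \<forall>h \<in> H. ?\<phi> h C = C}"
  have fin: "finite (rcosets H)" using finG sub by (simp add: RCOSETS_def)
  have index: "card (rcosets H) * card H = p ^ n" using lagrange[OF H] ord by simp
  interpret A: group_action "G\<lparr>carrier := H\<rparr>" "rcosets H" ?\<phi>
    using group_action.induced_action[OF action_on_right_cosets[OF H] H] .
  obtain a where "card H = p ^ a" using index divides_primepow_nat[OF p] by (metis dvd_triv_right)
  then have "p dvd card (rcosets H - ?F)"
    using A.p_group_dvd_card_moved_points[OF p _ fin, of a] by (simp add: order_def)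
  moreover have "p dvd card (rcosets H)"
  proof -
    have "card (rcosets H) \<noteq> 1"
    proof
      assume "card (rcosets H) = 1"
      then have "card H = card (carrier G)" using lagrange[OF H] by (simp add: order_def)
      then show False using proper card_subset_eq[OF finG sub] by blast
    qed
    moreover obtain b where "card (rcosets H) = p ^ b"
      using index divides_primepow_nat[OF p] by (metis dvd_triv_left)
    ultimately show ?thesis by (cases b) auto
  qed
  moreover have "card (rcosets H) = card (rcosets H - ?F) + card ?F"
    using fin by (subst card_Un_disjoint[symmetric]) (auto intro!: arg_cong[where f = card])
  ultimately have dvd_F: "p dvd card ?F" by (simp add: dvd_add_right_iff)
  have "C #> inv h = C" if "C = H" "h \<in> H" for C h
    using that sub subgroup.m_inv_closed[OF H] by (simp add: coset_join2[OF _ H] subset_iff)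
  then have HF: "H \<in> ?F" using subgroup.subgroup_in_rcosets[OF H is_group] by simp
  have "?F \<noteq> {H}"
  proof
    assume "?F = {H}"
    with dvd_F have "p dvd card {H}" by (simp only:)
    then show False using prime_gt_1_nat[OF p] by simp
  qed
  with HF obtain C where C: "C \<in> ?F" "C \<noteq> H" by blast
  then obtain g where g: "g \<in> carrier G" "C = H #> g" by (auto simp: RCOSETS_def)
  have gH: "g \<notin> H" using C g coset_join2[OF g(1) H] by blast
  (* Being fixed only says that the conjugate of H lies in H; finiteness makes them equal. *)
  have conj: "g <# H #> inv g \<subseteq> H"
  proof
    fix x assume "x \<in> g <# H #> inv g"
    then obtain h where h: "h \<in> H" "x = g \<otimes> h \<otimes> inv g"
      by (auto simp: l_coset_def r_coset_def)
    have hc: "h \<in> carrier G" and ih: "inv h \<in> H"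
      using h sub subgroup.m_inv_closed[OF H] by auto
    have "(H #> g) #> h = H #> g"
      using C(1) g ih hc by auto
    then have "H #> (g \<otimes> h) = H #> g" using g hc sub by (simp add: coset_mult_assoc)
    then have "H #> (g \<otimes> h \<otimes> inv g) = H"
      using g hc sub by (metis coset_mult_assoc coset_mult_one inv_closed m_closed r_inv)
    then show "x \<in> H" using coset_join1[OF _ _ H] h g hc by simp
  qed
  have "card (g <# H #> inv g) = card H"
  proof -
    have "g <# H #> inv g = (\<lambda>h. g \<otimes> h \<otimes> inv g) ` H"
      by (auto simp: l_coset_def r_coset_def)
    moreover have "inj_on (\<lambda>h. g \<otimes> h \<otimes> inv g) H"
      using g sub by (intro inj_onI) (auto simp: subset_iff)
    ultimately show ?thesis by (simp add: card_image)
  qed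
  then have "g <# H #> inv g = H"
    using conj card_subset_eq finite_subset[OF sub finG] by blast
  then have "g \<in> normalizer G H" using g sub by (simp add: normalizer_def stabilizer_def)
  then show thesis using gH that by blast
qed

text \<open>
  The quotient \<open>G Mod H\<close> is a nontrivial p-group, so it has a subgroup of order \<open>p\<close> by Sylow's
  theorem. Its preimage, the union of its cosets, is the desired subgroup.
\<close>
lemma (in group) normal_p_group_supergroup_step:
  assumes p: "Factorial_Ring.prime p" and ord: "order G = p ^ n"
    and H: "H \<lhd> G" and proper: "H \<noteq> carrier G"
  obtains K where "subgroup K G" "H \<subseteq> K" "card K = p * card H"
proof -
  interpret H: normal H G by (rule H)
  have Hs: "subgroup H G" by (rule H.subgroup_axioms)
  have finG: "finite (carrier G)"
    using ord p order_gt_0_iff_finite prime_gt_0_nat by simp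
  have index: "order (G Mod H) * card H = p ^ n"
    using lagrange[OF Hs] ord by (simp add: order_def FactGroup_def)
  then obtain b where b: "order (G Mod H) = p ^ b"
    using divides_primepow_nat[OF p] by (metis dvd_triv_left)
  have "b \<noteq> 0"
  proof
    assume "b = 0"
    then have "card H = card (carrier G)" using index b ord by (simp add: order_def)
    then show False using proper card_subset_eq[OF finG H.subset] by blast
  qed
  then have "order (G Mod H) = p ^ 1 * p ^ (b - 1)" using b by (cases b) auto
  moreover have "finite (carrier (G Mod H))"
    using finG by (simp add: carrier_FactGroup)
  ultimately obtain A where A: "subgroup A (G Mod H)" "card A = p"
    using sylow_thm[OF p H.factorgroup_is_group, of 1 "p ^ (b - 1)"] by auto
  have AE: "A \<subseteq> rcosets H" using subgroup.subset[OF A(1)] by (simp add: FactGroup_def)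
  have K: "subgroup (\<Union>A) G" using H.factgroup_subgroup_union_subgroup[OF A(1)] .
  have "H \<in> A" using subgroup.one_closed[OF A(1)] by simp
  moreover have "card (\<Union>A) = p * card H"
  proof -
    have "card H * card A = card (\<Union>A)"
    proof (rule card_partition)
      show "finite A" using A(2) p by (metis card.infinite not_prime_0)
      show "finite (\<Union>A)" using finite_subset[OF subgroup.subset[OF K] finG] .
      show "card c = card H" if "c \<in> A" for c
        using that AE card_rcosets_equal[OF _ H.subset] by auto
      show "c1 \<inter> c2 = {}" if "c1 \<in> A" "c2 \<in> A" "c1 \<noteq> c2" for c1 c2
        using that AE rcos_disjoint[OF Hs] by (auto simp: pairwise_def disjnt_def)
    qed
    then show ?thesis using A(2) by (simp add: mult.commute)
  qed
  ultimately show thesis using K that by blast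
qed

text \<open>
  Normality is recovered by passing to the normalizer, in which \<open>H\<close> is normal and, by the growth of
  normalizers, still proper.
\<close>
lemma (in group) p_group_supergroup_step:
  assumes p: "Factorial_Ring.prime p" and ord: "order G = p ^ n"
    and H: "subgroup H G" and proper: "H \<noteq> carrier G"
  obtains K where "subgroup K G" "H \<subseteq> K" "card K = p * card H"
proof -
  let ?N = "normalizer G H"
  obtain g where g: "g \<in> ?N" "g \<notin> H"
    using p_group_normalizer_grows[OF p ord H proper] .
  have N: "subgroup ?N G" using normalizer_imp_subgroup[OF subgroup.subset[OF H]] .
  have norm: "H \<lhd> G\<lparr>carrier := ?N\<rparr>" using subgroup_in_normalizer[OF H] .
  have "card ?N dvd p ^ n" using lagrange[OF N] ord by (metis dvd_triv_right)
  then obtain m where m: "card ?N = p ^ m" using divides_primepow_nat[OF p] by blast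
  interpret N: group "G\<lparr>carrier := ?N\<rparr>" using subgroup_imp_group[OF N] .
  obtain K where K: "subgroup K (G\<lparr>carrier := ?N\<rparr>)" "H \<subseteq> K" "card K = p * card H"
    using N.normal_p_group_supergroup_step[OF p _ norm, of m] m g by (auto simp: order_def)
  moreover have "subgroup K G" using incl_subgroup[OF N K(1)] .
  ultimately show thesis using that by blast
qed

lemma (in group) p_group_subgroup_of_index_above:
  assumes p: "Factorial_Ring.prime p" and ord: "order G = p ^ n"
    and H: "subgroup H G" and index: "card (rcosets H) = p ^ (i + k)"
  obtains K where "subgroup K G" "H \<subseteq> K" "card (rcosets K) = p ^ i"
proof -
  have "\<exists>K. subgroup K G \<and> H \<subseteq> K \<and> card (rcosets K) = p ^ i"
    using H index
  proof (induction k arbitrary: H)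
    case 0
    then show ?case by auto
  next
    case (Suc k)
    have p1: "p > 1" using p by (rule prime_gt_1_nat)
    have cH: "p ^ (i + Suc k) * card H = order G" using lagrange[OF Suc.prems(1)] Suc.prems(2) by simp
    have pos: "order G > 0" using ord p1 by simp
    have "H \<noteq> carrier G"
    proof
      assume "H = carrier G"
      then have "p ^ (i + Suc k) = 1" using cH pos by (simp add: order_def)
      then show False using p1 by simp
    qed
    then obtain K where K: "subgroup K G" "H \<subseteq> K" "card K = p * card H"
      using p_group_supergroup_step[OF p ord Suc.prems(1)] by blast
    have "card (rcosets K) * card K = p ^ (i + k) * card K"
      using lagrange[OF K(1)] cH K(3) by (simp add: mult_ac)
    moreover have "card K \<noteq> 0"
      using K(3) cH pos p1 by (metis mult_0_right mult_eq_0_iff not_less0 not_one_less_zero)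
    ultimately have "card (rcosets K) = p ^ (i + k)" by simp
    from Suc.IH[OF K(1) this] K(2) show ?case by blast
  qed
  then show thesis using that by blast
qed

section \<open>Generators and index\<close>

text \<open>
  As long as \<open>S\<close> generates a proper subgroup, an element outside it can be added to \<open>S\<close>. The index,
  a power of \<open>p\<close>, then becomes strictly smaller, so its exponent drops by at least one.
  Hence at most \<open>j\<close> further elements are needed.
\<close>
lemma (in group) p_group_min_generators_le_log_index:
  assumes p: "Factorial_Ring.prime p" and ord: "order G = p ^ n"
    and S: "S \<subseteq> carrier G" "finite S" and index: "card (rcosets (generate G S)) = p ^ j"
  shows "min_generators G \<le> card S + j"
  using S index
proof (induction j arbitrary: S rule: less_induct)
  case (less j)
  have finG: "finite (carrier G)"
    using ord p order_gt_0_iff_finite prime_gt_0_nat by simp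
  let ?H = "generate G S"
  have H: "subgroup ?H G" using generate_is_subgroup[OF less.prems(1)] .
  show ?case
  proof (cases "?H = carrier G")
    case True
    then have "min_generators G \<le> card S"
      unfolding min_generators_def
      by (intro Least_le exI[of _ S]) (simp add: less.prems(1,2))
    then show ?thesis by simp
  next
    case False
    then obtain g where g: "g \<in> carrier G" "g \<notin> ?H" using subgroup.subset[OF H] by blast
    let ?T = "insert g S"
    let ?K = "generate G ?T"
    have T: "?T \<subseteq> carrier G" "finite ?T" using g less.prems by auto
    have K: "subgroup ?K G" using generate_is_subgroup[OF T(1)] .
    have "card (rcosets ?K) dvd p ^ n" using lagrange[OF K] ord by (metis dvd_triv_left)
    then obtain k where k: "card (rcosets ?K) = p ^ k" using divides_primepow_nat[OF p] by blast
    have "?H \<subseteq> ?K" by (intro mono_generate) blast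
    moreover have "g \<in> ?K" by (rule generate.incl) simp
    ultimately have "?H \<subset> ?K" using g(2) by blast
    then have card_less: "card ?H < card ?K"
      using finite_subset[OF subgroup.subset[OF K] finG] by (rule psubset_card_mono[rotated])
    have orders: "p ^ j * card ?H = p ^ k * card ?K"
      using lagrange[OF H] lagrange[OF K] k less.prems(3) by simp
    have "p ^ k < p ^ j"
    proof (rule ccontr)
      assume "\<not> p ^ k < p ^ j"
      then have "p ^ j * card ?H \<le> p ^ k * card ?H" by simp
      also have "\<dots> < p ^ k * card ?K" using card_less prime_gt_0_nat[OF p] by simp
      finally show False using orders by simp
    qed
    then have kj: "k < j" using prime_gt_1_nat[OF p] by (simp add: power_strict_increasing_iff)
    then have "min_generators G \<le> card ?T + k" using less.IH[OF kj T k] by simp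
    moreover have "card ?T \<le> Suc (card S)" by (simp add: card_insert_if less.prems(2))
    ultimately show ?thesis using kj by linarith
  qed
qed

section \<open>Commutators inside powerful subgroups\<close>

lemma (in group) agemo_subgroup_mono:
  assumes "subgroup K G"
  shows "agemo (G\<lparr>carrier := K\<rparr>) p k \<subseteq> agemo G p k"
proof -
  let ?P = "{g [^]\<^bsub>G\<lparr>carrier := K\<rparr>\<^esub> (p ^ k) | g. g \<in> carrier (G\<lparr>carrier := K\<rparr>)}"
  have pow: "?P = {g [^] (p ^ k) | g. g \<in> K}"
    by (simp add: nat_pow_consistent[symmetric])
  have "agemo (G\<lparr>carrier := K\<rparr>) p k = generate G {g [^] (p ^ k) | g. g \<in> K}"
    unfolding agemo_def pow
    using monoid.nat_pow_closed[OF group.is_monoid[OF subgroup_imp_group[OF assms]]]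
    by (intro generate_consistent assms) (auto simp: nat_pow_consistent[symmetric])
  also have "\<dots> \<subseteq> agemo G p k"
    unfolding agemo_def using subgroup.subset[OF assms] by (intro mono_generate) blast
  finally show ?thesis .
qed

theorem theoremB:
  fixes G :: "('a, 'b) monoid_scheme" and p i :: nat
  assumes "Factorial_Ring.prime p"
    and "finite_p_group p G"
    and "M_group p i G"
    and "min_generators G \<ge> i + 2"
  shows "powerful p G"
proof -
  note p = assms(1)
  interpret group G using assms(2) by (simp add: finite_p_group_def)
  obtain n where ord: "order G = p ^ n" using assms(2) by (auto simp: finite_p_group_def)
  (* The exponent of p in the definition of powerful depends on p, but not on the group. *)
  define e :: nat where "e = (if p = 2 then 2 else 1)"
  have powerful_iff: "powerful p H \<longleftrightarrow> derived H (carrier H) \<subseteq> agemo H p e"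
    for H :: "('a, 'b) monoid_scheme"
    by (simp add: powerful_def e_def)
  have "x \<otimes>\<^bsub>G\<^esub> y \<otimes>\<^bsub>G\<^esub> inv\<^bsub>G\<^esub> x \<otimes>\<^bsub>G\<^esub> inv\<^bsub>G\<^esub> y \<in> agemo G p e" if xy: "x \<in> carrier G" "y \<in> carrier G" for x y
  proof -
    let ?H = "generate G {x, y}"
    have H: "subgroup ?H G" using generate_is_subgroup[of "{x, y}"] xy by simp
    have "card (rcosets\<^bsub>G\<^esub> ?H) dvd p ^ n" using lagrange[OF H] ord by (metis dvd_triv_left)
    then obtain j where j: "card (rcosets\<^bsub>G\<^esub> ?H) = p ^ j" using divides_primepow_nat[OF p] by blast
    (* card {x, y} may be 1; only the bound by 2 matters. *)
    have "min_generators G \<le> card {x, y} + j"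
      using p_group_min_generators_le_log_index[OF p ord _ _ j] xy by simp
    moreover have "card {x, y} \<le> 2" by (simp add: card_insert_if)
    ultimately have "i \<le> j" using assms(4) by linarith
    then have "card (rcosets\<^bsub>G\<^esub> ?H) = p ^ (i + (j - i))" using j by simp
    then obtain K where K: "subgroup K G" "?H \<subseteq> K" "card (rcosets\<^bsub>G\<^esub> K) = p ^ i"
      using p_group_subgroup_of_index_above[OF p ord H] by blast
    have "powerful p (G\<lparr>carrier := K\<rparr>)" using assms(3) K by (auto simp: M_group_def)
    then have "derived G K \<subseteq> agemo (G\<lparr>carrier := K\<rparr>) p e"
      using derived_consistent[OF subset_refl K(1)] by (simp add: powerful_iff)
    moreover have "x \<otimes>\<^bsub>G\<^esub> y \<otimes>\<^bsub>G\<^esub> inv\<^bsub>G\<^esub> x \<otimes>\<^bsub>G\<^esub> inv\<^bsub>G\<^esub> y \<in> derived G K"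
    proof -
      have "x \<in> K" "y \<in> K" using K(2) generate.incl[of _ "{x, y}" G] by auto
      then show ?thesis unfolding derived_def by (intro generate.incl) blast
    qed
    ultimately show ?thesis using agemo_subgroup_mono[OF K(1)] by blast
  qed
  moreover have "subgroup (agemo G p e) G"
    unfolding agemo_def by (intro generate_is_subgroup) auto
  ultimately show ?thesis
    unfolding powerful_iff derived_def by (intro generate_subgroup_incl) auto
qed

end
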